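(* Let $\mathcal{P}=(P,\{\,,\,\})$, $P=P_0\ltimes P_1$, be an admissible Poisson algebra. Then $\mathcal{P}$ is induced by a Poisson module over $\mathcal{P}_0$ if and only if the corresponding Poisson triple of $P$ is of the form $([\,,\,]_1=0,\ \mathcal{D},\ \mathcal{K}=0)$. Moreover, in this case the Poisson module structure over $\mathcal{P}_0$ is defined by the formula $\lambda(f,\eta)=\mathcal{D}_{df}\eta$ for $f\in P_0$, $\eta\in P_1$.
   Context: Let $R$ be a commutative ring with unit, $\mathcal{P}_0=(P_0,\cdot,\{\,,\,\}_0)$ a Poisson $R$-algebra (commutative associative unital $R$-algebra with an $R$-bilinear Lie bracket that is a derivation in each argument), $P_1$ a faithful $P_0$-module, and $P=P_0\ltimes P_1$ the $R$-module $P_0\oplus P_1$ with product $(f\oplus\eta)(g\oplus\xi)=fg\oplus(f\xi+g\eta)$. An admissible Poisson structure on $P$ is a Poisson structure with $\mathrm{pr}_0\{f\oplus\eta,g\oplus\xi\}=\{f,g\}_0$; $(P,\{\,,\,\})$ is then an admissible Poisson algebra. $\Omega^1_{P_0}$ is the module of Kähler differentials of $P_0$ over $R$ with universal derivation $d$, anchor $\varrho_{P_0}(dh)=\{h,\cdot\}_0$ (extended $P_0$-linearly). A contravariant derivative on $P_1$ is an $R$-bilinear map $\mathcal{D}:\Omega^1_{P_0}\times P_1\to P_1$ with $\mathcal{D}_{f\alpha}\eta=f\mathcal{D}_\alpha\eta$, $\mathcal{D}_\alpha(f\eta)=f\mathcal{D}_\alpha\eta+\varrho_{P_0}(\alpha)(f)\eta$.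 Every admissible Poisson algebra has a unique corresponding Poisson triple $([\,,\,]_1,\mathcal{D},\mathcal{K})$, where $[\,,\,]_1$ is a $P_0$-linear Lie bracket on $P_1$, $\mathcal{D}$ a contravariant derivative on $P_1$, and $\mathcal{K}:\Omega^1_{P_0}\times\Omega^1_{P_0}\to P_1$ a $P_0$-bilinear skew-symmetric map, such that $\{f\oplus\eta,g\oplus\xi\}=\{f,g\}_0\oplus(\mathcal{D}_{df}\xi-\mathcal{D}_{dg}\eta+[\eta,\xi]_1+\mathcal{K}(df,dg))$. A Poisson module over $\mathcal{P}_0$ is a pair $(P_1,\lambda)$ with $\lambda:P_0\times P_1\to P_1$ $R$-bilinear and $\lambda(f,g\eta)=g\lambda(f,\eta)+\{f,g\}_0\eta$, $\lambda(fg,\eta)=f\lambda(g,\eta)+g\lambda(f,\eta)$, $\lambda(\{f,g\}_0,\eta)=\lambda(f,\lambda(g,\eta))-\lambda(g,\lambda(f,\eta))$. The admissible Poisson algebra induced by it has bracket $\{f\oplus\eta,g\oplus\xi\}_\lambda=\{f,g\}_0\oplus(\lambda(f,\xi)-\lambda(g,\eta))$. *)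

theory Defs
  imports "HOL-Algebra.Algebra"
begin

text \<open>
  Rings, modules and algebras are those of HOL-Algebra, so every map between them is a total
  HOL function of which only the values on the carriers matter. Module records inherit the fields
  \<open>mult\<close> and \<open>one\<close> from ring records; for structures that are merely modules these two
  fields are irrelevant and are left undefined below.
\<close>

text \<open>
  An \<open>A\<close>-module over an \<open>R\<close>-algebra \<open>A\<close> is regarded as an \<open>R\<close>-module via \<open>r x = (r 1) x\<close>.
\<close>

definition restrict_scalars :: "('r, 'a) module \<Rightarrow> ('a, 'm) module \<Rightarrow> ('r, 'm) module" where
  "restrict_scalars A M =
     \<lparr>carrier = carrier M, monoid.mult = undefined, one = undefined,
      ring.zero = \<zero>\<^bsub>M\<^esub>, add = (\<oplus>\<^bsub>M\<^esub>),
      smult = (\<lambda>r x. (r \<odot>\<^bsub>A\<^esub> \<one>\<^bsub>A\<^esub>) \<odot>\<^bsub>M\<^esub> x)\<rparr>"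

definition regular_module :: "('r, 'a) module \<Rightarrow> ('a, 'a) module" where
  "regular_module A =
     \<lparr>carrier = carrier A, monoid.mult = (\<otimes>\<^bsub>A\<^esub>), one = \<one>\<^bsub>A\<^esub>,
      ring.zero = \<zero>\<^bsub>A\<^esub>, add = (\<oplus>\<^bsub>A\<^esub>), smult = (\<otimes>\<^bsub>A\<^esub>)\<rparr>"

definition faithful_module :: "('r, 'a) module \<Rightarrow> ('a, 'm) module \<Rightarrow> bool" where
  "faithful_module A M \<longleftrightarrow> module A M \<and>
     (\<forall>f\<in>carrier A. (\<forall>x\<in>carrier M. f \<odot>\<^bsub>M\<^esub> x = \<zero>\<^bsub>M\<^esub>) \<longrightarrow> f = \<zero>\<^bsub>A\<^esub>)"

definition bilinear_map ::
    "('r, 's) ring_scheme \<Rightarrow> ('r, 'a) module \<Rightarrow> ('r, 'b) module \<Rightarrow> ('r, 'c) module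
      \<Rightarrow> ('a \<Rightarrow> 'b \<Rightarrow> 'c) \<Rightarrow> bool" where
  "bilinear_map R L M N b \<longleftrightarrow>
     (\<forall>x\<in>carrier L. \<forall>y\<in>carrier M. b x y \<in> carrier N) \<and>
     (\<forall>x\<in>carrier L. \<forall>x'\<in>carrier L. \<forall>y\<in>carrier M. b (x \<oplus>\<^bsub>L\<^esub> x') y = b x y \<oplus>\<^bsub>N\<^esub> b x' y) \<and>
     (\<forall>x\<in>carrier L. \<forall>y\<in>carrier M. \<forall>y'\<in>carrier M. b x (y \<oplus>\<^bsub>M\<^esub> y') = b x y \<oplus>\<^bsub>N\<^esub> b x y') \<and>
     (\<forall>r\<in>carrier R. \<forall>x\<in>carrier L. \<forall>y\<in>carrier M. b (r \<odot>\<^bsub>L\<^esub> x) y = r \<odot>\<^bsub>N\<^esub> b x y) \<and>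
     (\<forall>r\<in>carrier R. \<forall>x\<in>carrier L. \<forall>y\<in>carrier M. b x (r \<odot>\<^bsub>M\<^esub> y) = r \<odot>\<^bsub>N\<^esub> b x y)"

definition vanishing_map ::
    "('r, 'a) module \<Rightarrow> ('r, 'b) module \<Rightarrow> ('r, 'c) module \<Rightarrow> ('a \<Rightarrow> 'b \<Rightarrow> 'c) \<Rightarrow> bool" where
  "vanishing_map L M N b \<longleftrightarrow> (\<forall>x\<in>carrier L. \<forall>y\<in>carrier M. b x y = \<zero>\<^bsub>N\<^esub>)"

text \<open>
  The base ring may have characteristic two, so antisymmetry of Lie brackets is imposed in the
  alternating form.
\<close>

definition lie_bracket ::
    "('r, 's) ring_scheme \<Rightarrow> ('r, 'a) module \<Rightarrow> ('a \<Rightarrow> 'a \<Rightarrow> 'a) \<Rightarrow> bool" where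
  "lie_bracket R M br \<longleftrightarrow>
     bilinear_map R M M M br \<and>
     (\<forall>x\<in>carrier M. br x x = \<zero>\<^bsub>M\<^esub>) \<and>
     (\<forall>x\<in>carrier M. \<forall>y\<in>carrier M. \<forall>z\<in>carrier M.
        br x (br y z) \<oplus>\<^bsub>M\<^esub> br y (br z x) \<oplus>\<^bsub>M\<^esub> br z (br x y) = \<zero>\<^bsub>M\<^esub>)"

definition poisson_algebra ::
    "('r, 's) ring_scheme \<Rightarrow> ('r, 'a) module \<Rightarrow> ('a \<Rightarrow> 'a \<Rightarrow> 'a) \<Rightarrow> bool" where
  "poisson_algebra R A br \<longleftrightarrow>
     algebra R A \<and> lie_bracket R A br \<and>
     (\<forall>f\<in>carrier A. \<forall>g\<in>carrier A. \<forall>h\<in>carrier A.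
        br (f \<otimes>\<^bsub>A\<^esub> g) h = f \<otimes>\<^bsub>A\<^esub> br g h \<oplus>\<^bsub>A\<^esub> g \<otimes>\<^bsub>A\<^esub> br f h \<and>
        br h (f \<otimes>\<^bsub>A\<^esub> g) = f \<otimes>\<^bsub>A\<^esub> br h g \<oplus>\<^bsub>A\<^esub> g \<otimes>\<^bsub>A\<^esub> br h f)"

definition semidirect :: "('r, 'a) module \<Rightarrow> ('a, 'm) module \<Rightarrow> ('r, 'a \<times> 'm) module" where
  "semidirect P0 P1 =
     \<lparr>carrier = carrier P0 \<times> carrier P1,
      monoid.mult = (\<lambda>(f, \<eta>) (g, \<xi>). (f \<otimes>\<^bsub>P0\<^esub> g, f \<odot>\<^bsub>P1\<^esub> \<xi> \<oplus>\<^bsub>P1\<^esub> g \<odot>\<^bsub>P1\<^esub> \<eta>)),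
      one = (\<one>\<^bsub>P0\<^esub>, \<zero>\<^bsub>P1\<^esub>),
      ring.zero = (\<zero>\<^bsub>P0\<^esub>, \<zero>\<^bsub>P1\<^esub>),
      add = (\<lambda>(f, \<eta>) (g, \<xi>). (f \<oplus>\<^bsub>P0\<^esub> g, \<eta> \<oplus>\<^bsub>P1\<^esub> \<xi>)),
      smult = (\<lambda>r (f, \<eta>). (r \<odot>\<^bsub>P0\<^esub> f, r \<odot>\<^bsub>restrict_scalars P0 P1\<^esub> \<eta>))\<rparr>"

definition admissible_poisson ::
    "('r, 's) ring_scheme \<Rightarrow> ('r, 'a) module \<Rightarrow> ('a \<Rightarrow> 'a \<Rightarrow> 'a) \<Rightarrow> ('a, 'm) module
      \<Rightarrow> ('a \<times> 'm \<Rightarrow> 'a \<times> 'm \<Rightarrow> 'a \<times> 'm) \<Rightarrow> bool" where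
  "admissible_poisson R P0 br0 P1 br \<longleftrightarrow>
     poisson_algebra R (semidirect P0 P1) br \<and>
     (\<forall>f\<in>carrier P0. \<forall>\<eta>\<in>carrier P1. \<forall>g\<in>carrier P0. \<forall>\<xi>\<in>carrier P1.
        fst (br (f, \<eta>) (g, \<xi>)) = br0 f g)"

text \<open>
  The module of differentials of the \<open>R\<close>-algebra \<open>A\<close> is the free \<open>A\<close>-module on the carrier of \<open>A\<close>
  (finitely supported functions) modulo the submodule generated by the relations making
  \<open>h \<mapsto> d h\<close> an \<open>R\<close>-linear derivation. Its elements are cosets.
\<close>

definition free_module :: "('r, 'a) module \<Rightarrow> ('a, 'a \<Rightarrow> 'a) module" where
  "free_module A =
     \<lparr>carrier = {c. (\<forall>h. c h \<in> carrier A) \<and> {h. c h \<noteq> \<zero>\<^bsub>A\<^esub>} \<subseteq> carrier A \<and>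
                   finite {h. c h \<noteq> \<zero>\<^bsub>A\<^esub>}},
      monoid.mult = undefined, one = undefined,
      ring.zero = (\<lambda>h. \<zero>\<^bsub>A\<^esub>),
      add = (\<lambda>c c' h. c h \<oplus>\<^bsub>A\<^esub> c' h),
      smult = (\<lambda>f c h. f \<otimes>\<^bsub>A\<^esub> c h)\<rparr>"

definition free_gen :: "('r, 'a) module \<Rightarrow> 'a \<Rightarrow> 'a \<Rightarrow> 'a" where
  "free_gen A h = (\<lambda>k. if k = h then \<one>\<^bsub>A\<^esub> else \<zero>\<^bsub>A\<^esub>)"

definition kaehler_relations :: "('r, 's) ring_scheme \<Rightarrow> ('r, 'a) module \<Rightarrow> ('a \<Rightarrow> 'a) set" where
  "kaehler_relations R A = (let F = free_module A; \<delta> = free_gen A in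
     {\<delta> (f \<oplus>\<^bsub>A\<^esub> g) \<ominus>\<^bsub>F\<^esub> (\<delta> f \<oplus>\<^bsub>F\<^esub> \<delta> g) |f g. f \<in> carrier A \<and> g \<in> carrier A} \<union>
     {\<delta> (r \<odot>\<^bsub>A\<^esub> f) \<ominus>\<^bsub>F\<^esub> (r \<odot>\<^bsub>A\<^esub> \<one>\<^bsub>A\<^esub>) \<odot>\<^bsub>F\<^esub> \<delta> f |r f. r \<in> carrier R \<and> f \<in> carrier A} \<union>
     {\<delta> (f \<otimes>\<^bsub>A\<^esub> g) \<ominus>\<^bsub>F\<^esub> (f \<odot>\<^bsub>F\<^esub> \<delta> g \<oplus>\<^bsub>F\<^esub> g \<odot>\<^bsub>F\<^esub> \<delta> f) |f g. f \<in> carrier A \<and> g \<in> carrier A})"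

definition kaehler_submodule :: "('r, 's) ring_scheme \<Rightarrow> ('r, 'a) module \<Rightarrow> ('a \<Rightarrow> 'a) set" where
  "kaehler_submodule R A =
     \<Inter>{N. submodule N A (free_module A) \<and> kaehler_relations R A \<subseteq> N}"

definition kaehler ::
    "('r, 's) ring_scheme \<Rightarrow> ('r, 'a) module \<Rightarrow> ('a, ('a \<Rightarrow> 'a) set) module" where
  "kaehler R A = (let F = free_module A; N = kaehler_submodule R A in
     \<lparr>carrier = a_rcosets\<^bsub>F\<^esub> N, monoid.mult = undefined, one = undefined,
      ring.zero = N,
      add = set_add F,
      smult = (\<lambda>f \<omega>. \<Union>c\<in>\<omega>. N +>\<^bsub>F\<^esub> (f \<odot>\<^bsub>F\<^esub> c))\<rparr>)"

definition univ_deriv ::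
    "('r, 's) ring_scheme \<Rightarrow> ('r, 'a) module \<Rightarrow> 'a \<Rightarrow> ('a \<Rightarrow> 'a) set" where
  "univ_deriv R A h = kaehler_submodule R A +>\<^bsub>free_module A\<^esub> free_gen A h"

text \<open>
  For an \<open>R\<close>-linear derivation \<open>\<delta>\<close> of \<open>A\<close> into an \<open>A\<close>-module \<open>M\<close>, \<open>kaehler_lift A M \<delta>\<close> is the
  \<open>A\<close>-linear map on differentials with \<open>d h \<mapsto> \<delta> h\<close>; the value does not depend on the
  representative of the coset \<open>\<omega>\<close>, so the set below is a singleton.
\<close>

definition kaehler_lift ::
    "('r, 'a) module \<Rightarrow> ('a, 'm) module \<Rightarrow> ('a \<Rightarrow> 'm) \<Rightarrow> ('a \<Rightarrow> 'a) set \<Rightarrow> 'm" where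
  "kaehler_lift A M \<delta> \<omega> =
     the_elem ((\<lambda>c. \<Oplus>\<^bsub>M\<^esub>h\<in>{h. c h \<noteq> \<zero>\<^bsub>A\<^esub>}. c h \<odot>\<^bsub>M\<^esub> \<delta> h) ` \<omega>)"

definition anchor ::
    "('r, 'a) module \<Rightarrow> ('a \<Rightarrow> 'a \<Rightarrow> 'a) \<Rightarrow> ('a \<Rightarrow> 'a) set \<Rightarrow> 'a \<Rightarrow> 'a" where
  "anchor P0 br0 \<omega> f = kaehler_lift P0 (regular_module P0) (\<lambda>h. br0 h f) \<omega>"

definition contravariant_derivative ::
    "('r, 's) ring_scheme \<Rightarrow> ('r, 'a) module \<Rightarrow> ('a \<Rightarrow> 'a \<Rightarrow> 'a) \<Rightarrow> ('a, 'm) module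
      \<Rightarrow> (('a \<Rightarrow> 'a) set \<Rightarrow> 'm \<Rightarrow> 'm) \<Rightarrow> bool" where
  "contravariant_derivative R P0 br0 P1 D \<longleftrightarrow>
     bilinear_map R (restrict_scalars P0 (kaehler R P0)) (restrict_scalars P0 P1)
       (restrict_scalars P0 P1) D \<and>
     (\<forall>f\<in>carrier P0. \<forall>\<alpha>\<in>carrier (kaehler R P0). \<forall>\<eta>\<in>carrier P1.
        D (f \<odot>\<^bsub>kaehler R P0\<^esub> \<alpha>) \<eta> = f \<odot>\<^bsub>P1\<^esub> D \<alpha> \<eta> \<and>
        D \<alpha> (f \<odot>\<^bsub>P1\<^esub> \<eta>) = f \<odot>\<^bsub>P1\<^esub> D \<alpha> \<eta> \<oplus>\<^bsub>P1\<^esub> anchor P0 br0 \<alpha> f \<odot>\<^bsub>P1\<^esub> \<eta>)"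

definition corresponding_poisson_triple ::
    "('r, 's) ring_scheme \<Rightarrow> ('r, 'a) module \<Rightarrow> ('a \<Rightarrow> 'a \<Rightarrow> 'a) \<Rightarrow> ('a, 'm) module
      \<Rightarrow> ('a \<times> 'm \<Rightarrow> 'a \<times> 'm \<Rightarrow> 'a \<times> 'm)
      \<Rightarrow> ('m \<Rightarrow> 'm \<Rightarrow> 'm) \<Rightarrow> (('a \<Rightarrow> 'a) set \<Rightarrow> 'm \<Rightarrow> 'm)
      \<Rightarrow> (('a \<Rightarrow> 'a) set \<Rightarrow> ('a \<Rightarrow> 'a) set \<Rightarrow> 'm) \<Rightarrow> bool" where
  "corresponding_poisson_triple R P0 br0 P1 br br1 D K \<longleftrightarrow>
     (let \<Omega> = kaehler R P0; d = univ_deriv R P0 in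
      lie_bracket P0 P1 br1 \<and>
      contravariant_derivative R P0 br0 P1 D \<and>
      bilinear_map P0 \<Omega> \<Omega> P1 K \<and>
      (\<forall>\<alpha>\<in>carrier \<Omega>. \<forall>\<beta>\<in>carrier \<Omega>. K \<alpha> \<beta> = \<ominus>\<^bsub>P1\<^esub> K \<beta> \<alpha>) \<and>
      (\<forall>f\<in>carrier P0. \<forall>\<eta>\<in>carrier P1. \<forall>g\<in>carrier P0. \<forall>\<xi>\<in>carrier P1.
         br (f, \<eta>) (g, \<xi>) =
           (br0 f g, D (d f) \<xi> \<ominus>\<^bsub>P1\<^esub> D (d g) \<eta> \<oplus>\<^bsub>P1\<^esub> br1 \<eta> \<xi> \<oplus>\<^bsub>P1\<^esub> K (d f) (d g))))"

definition poisson_module ::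
    "('r, 's) ring_scheme \<Rightarrow> ('r, 'a) module \<Rightarrow> ('a \<Rightarrow> 'a \<Rightarrow> 'a) \<Rightarrow> ('a, 'm) module
      \<Rightarrow> ('a \<Rightarrow> 'm \<Rightarrow> 'm) \<Rightarrow> bool" where
  "poisson_module R P0 br0 P1 lam \<longleftrightarrow>
     bilinear_map R P0 (restrict_scalars P0 P1) (restrict_scalars P0 P1) lam \<and>
     (\<forall>f\<in>carrier P0. \<forall>g\<in>carrier P0. \<forall>\<eta>\<in>carrier P1.
        lam f (g \<odot>\<^bsub>P1\<^esub> \<eta>) = g \<odot>\<^bsub>P1\<^esub> lam f \<eta> \<oplus>\<^bsub>P1\<^esub> br0 f g \<odot>\<^bsub>P1\<^esub> \<eta> \<and>
        lam (f \<otimes>\<^bsub>P0\<^esub> g) \<eta> = f \<odot>\<^bsub>P1\<^esub> lam g \<eta> \<oplus>\<^bsub>P1\<^esub> g \<odot>\<^bsub>P1\<^esub> lam f \<eta> \<and>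
        lam (br0 f g) \<eta> = lam f (lam g \<eta>) \<ominus>\<^bsub>P1\<^esub> lam g (lam f \<eta>))"

definition induced_by ::
    "('r, 'a) module \<Rightarrow> ('a \<Rightarrow> 'a \<Rightarrow> 'a) \<Rightarrow> ('a, 'm) module
      \<Rightarrow> ('a \<times> 'm \<Rightarrow> 'a \<times> 'm \<Rightarrow> 'a \<times> 'm) \<Rightarrow> ('a \<Rightarrow> 'm \<Rightarrow> 'm) \<Rightarrow> bool" where
  "induced_by P0 br0 P1 br lam \<longleftrightarrow>
     (\<forall>f\<in>carrier P0. \<forall>\<eta>\<in>carrier P1. \<forall>g\<in>carrier P0. \<forall>\<xi>\<in>carrier P1.
        br (f, \<eta>) (g, \<xi>) = (br0 f g, lam f \<xi> \<ominus>\<^bsub>P1\<^esub> lam g \<eta>))"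

end

theory Submission
  imports Defs
begin

text \<open>
  With \<open>\<lambda>(f, \<eta>) = \<D>\<^bsub>df\<^esub> \<eta>\<close>, vanishing of \<open>[\<eta>, \<xi>]\<^sub>1\<close> and \<open>\<K>\<close> says exactly that the bracket of the
  semidirect product is \<open>{f \<oplus> \<eta>, g \<oplus> \<xi>} = {f, g}\<^sub>0 \<oplus> (\<lambda>(f, \<xi>) - \<lambda>(g, \<eta>))\<close>, and the axioms of a
  Poisson module are then the Leibniz and Jacobi identities of this bracket on elements \<open>f \<oplus> 0\<close>
  and \<open>0 \<oplus> \<eta>\<close>. Conversely, for an induced bracket the pairs \<open>(0 \<oplus> \<eta>, 0 \<oplus> \<xi>)\<close> and
  \<open>(f \<oplus> 0, g \<oplus> 0)\<close> show \<open>[\<eta>, \<xi>]\<^sub>1 = 0\<close> and \<open>\<K>(df, dg) = 0\<close>, and exact differentials generate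
  the module of differentials.
\<close>

section \<open>Generation of the module of differentials\<close>

lemma free_module_simps:
  "\<zero>\<^bsub>free_module A\<^esub> = (\<lambda>h. \<zero>\<^bsub>A\<^esub>)"
  "c \<oplus>\<^bsub>free_module A\<^esub> c' = (\<lambda>h. c h \<oplus>\<^bsub>A\<^esub> c' h)"
  "f \<odot>\<^bsub>free_module A\<^esub> c = (\<lambda>h. f \<otimes>\<^bsub>A\<^esub> c h)"
  by (simp_all add: free_module_def)

lemma mem_free_module_iff:
  "c \<in> carrier (free_module A) \<longleftrightarrow>
     (\<forall>h. c h \<in> carrier A) \<and> {h. c h \<noteq> \<zero>\<^bsub>A\<^esub>} \<subseteq> carrier A \<and> finite {h. c h \<noteq> \<zero>\<^bsub>A\<^esub>}"
  by (simp add: free_module_def)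

lemma module_free_module:
  fixes A :: "('r, 'a) module"
  assumes "cring A"
  shows "module A (free_module A)"
proof -
  interpret A: cring A by fact
  \<comment> \<open>All operations of the free module are pointwise, so the only real closure
    condition is on supports: that of \<open>u\<close> lies in the union of two finite supports
    inside the carrier. Negation and scalar multiples use the case \<open>c' = c\<close>.\<close>
  have closed: "(\<lambda>h. u h) \<in> carrier (free_module A)"
    if "\<And>h. u h \<in> carrier A" "\<And>h. u h \<noteq> \<zero>\<^bsub>A\<^esub> \<Longrightarrow> c h \<noteq> \<zero>\<^bsub>A\<^esub> \<or> c' h \<noteq> \<zero>\<^bsub>A\<^esub>"
      "c \<in> carrier (free_module A)" "c' \<in> carrier (free_module A)" for u c c'
  proof -
    have "{h. u h \<noteq> \<zero>\<^bsub>A\<^esub>} \<subseteq> {h. c h \<noteq> \<zero>\<^bsub>A\<^esub>} \<union> {h. c' h \<noteq> \<zero>\<^bsub>A\<^esub>}"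
      using that(2) by blast
    then show ?thesis
      using that unfolding mem_free_module_iff by (meson finite_UnI finite_subset le_supI subset_trans)
  qed
  have inv: "\<exists>y\<in>carrier (free_module A). y \<oplus>\<^bsub>free_module A\<^esub> c = \<zero>\<^bsub>free_module A\<^esub>"
    if c: "c \<in> carrier (free_module A)" for c
  proof
    have ca: "c h \<in> carrier A" for h
      using c by (simp add: mem_free_module_iff)
    show "(\<lambda>h. \<ominus>\<^bsub>A\<^esub> c h) \<in> carrier (free_module A)"
      by (rule closed[OF _ _ c c]) (use ca in auto)
    show "(\<lambda>h. \<ominus>\<^bsub>A\<^esub> c h) \<oplus>\<^bsub>free_module A\<^esub> c = \<zero>\<^bsub>free_module A\<^esub>"
      using ca by (simp add: free_module_simps A.l_neg)
  qed
  have "abelian_group (free_module A)"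
  proof (rule abelian_groupI)
    fix c c' assume c: "c \<in> carrier (free_module A)" "c' \<in> carrier (free_module A)"
    show "c \<oplus>\<^bsub>free_module A\<^esub> c' \<in> carrier (free_module A)"
      unfolding free_module_simps by (rule closed[OF _ _ c]) (use c in \<open>auto simp: mem_free_module_iff\<close>)
  qed (use inv in \<open>auto simp: free_module_simps mem_free_module_iff A.a_ac\<close>)
  then show ?thesis
  proof (rule moduleI[OF assms])
    fix f c assume c: "f \<in> carrier A" "c \<in> carrier (free_module A)"
    show "f \<odot>\<^bsub>free_module A\<^esub> c \<in> carrier (free_module A)"
      unfolding free_module_simps
      by (rule closed[OF _ _ c(2) c(2)]) (use c in \<open>auto simp: mem_free_module_iff\<close>)
  qed (auto simp: free_module_simps mem_free_module_iff A.l_distr A.r_distr A.m_assoc)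
qed

lemma free_gen_closed:
  fixes A :: "('r, 'a) module"
  assumes "cring A" "h \<in> carrier A"
  shows "free_gen A h \<in> carrier (free_module A)"
proof -
  interpret A: cring A by fact
  have "{k. free_gen A h k \<noteq> \<zero>\<^bsub>A\<^esub>} \<subseteq> {h}"
    by (auto simp: free_gen_def)
  then show ?thesis
    using assms(2) by (auto simp: mem_free_module_iff free_gen_def intro: finite_subset)
qed

section \<open>The submodule of relations and its cosets\<close>

lemma submodule_kaehler_submodule:
  assumes "algebra R A"
  shows "submodule (kaehler_submodule R A) A (free_module A)"
proof -
  interpret A: algebra R A by fact
  interpret F: module A "free_module A"
    using A.M_cring by (rule module_free_module)
  have gen: "free_gen A h \<in> carrier (free_module A)" if "h \<in> carrier A" for h
    using A.M_cring that by (rule free_gen_closed)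
  have rel: "kaehler_relations R A \<subseteq> carrier (free_module A)"
    unfolding kaehler_relations_def Let_def by (auto intro!: gen F.M.minus_closed)
  \<comment> \<open>The whole free module is one member of the intersected family. This bounds the
    intersection by the carrier; an empty family would give the universal set.\<close>
  have carr: "carrier (free_module A)
      \<in> {N. submodule N A (free_module A) \<and> kaehler_relations R A \<subseteq> N}"
    using rel F.carrier_is_submodule by simp
  show ?thesis
  proof (rule F.submoduleI)
    show "kaehler_submodule R A \<subseteq> carrier (free_module A)"
      unfolding kaehler_submodule_def using carr by (rule Inter_lower)
    show "\<zero>\<^bsub>free_module A\<^esub> \<in> kaehler_submodule R A"
      unfolding kaehler_submodule_def
      using submodule.axioms(1) subgroup.one_closed by fastforce
  qed (auto simp: kaehler_submodule_def intro: F.submoduleE)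
qed

lemma kaehler_simps:
  "carrier (kaehler R A) = a_rcosets\<^bsub>free_module A\<^esub> (kaehler_submodule R A)"
  "\<alpha> \<oplus>\<^bsub>kaehler R A\<^esub> \<beta> = \<alpha> <+>\<^bsub>free_module A\<^esub> \<beta>"
  "f \<odot>\<^bsub>kaehler R A\<^esub> \<alpha>
     = (\<Union>c\<in>\<alpha>. kaehler_submodule R A +>\<^bsub>free_module A\<^esub> (f \<odot>\<^bsub>free_module A\<^esub> c))"
  by (simp_all add: kaehler_def Let_def)

lemma abelian_subgroup_kaehler_submodule:
  assumes "algebra R A"
  shows "abelian_subgroup (kaehler_submodule R A) (free_module A)"
proof (rule abelian_subgroupI2)
  interpret A: algebra R A by fact
  interpret F: module A "free_module A"
    using A.M_cring by (rule module_free_module)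
  show "comm_group (add_monoid (free_module A))"
    by (rule F.a_comm_group)
  show "subgroup (kaehler_submodule R A) (add_monoid (free_module A))"
    using submodule_kaehler_submodule[OF assms] by (rule submodule.axioms(1))
qed

text \<open>The scalar action on a coset is a union over all representatives. Two representatives
  differ by an element \<open>n\<close> of the relation submodule, and \<open>f\<close> times
  \<open>n\<close> stays in it, so all cosets in the union coincide.\<close>

lemma kaehler_smult_coset:
  assumes "algebra R A" "f \<in> carrier A" "c \<in> carrier (free_module A)"
  shows "f \<odot>\<^bsub>kaehler R A\<^esub> (kaehler_submodule R A +>\<^bsub>free_module A\<^esub> c)
    = kaehler_submodule R A +>\<^bsub>free_module A\<^esub> (f \<odot>\<^bsub>free_module A\<^esub> c)"
proof -
  interpret A: algebra R A by fact
  interpret F: module A "free_module A"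
    using A.M_cring by (rule module_free_module)
  interpret N: abelian_subgroup "kaehler_submodule R A" "free_module A"
    using assms(1) by (rule abelian_subgroup_kaehler_submodule)
  interpret S: submodule "kaehler_submodule R A" A "free_module A"
    using assms(1) by (rule submodule_kaehler_submodule)
  let ?F = "free_module A" and ?N = "kaehler_submodule R A"
  have "?N +>\<^bsub>?F\<^esub> (f \<odot>\<^bsub>?F\<^esub> c') = ?N +>\<^bsub>?F\<^esub> (f \<odot>\<^bsub>?F\<^esub> c)" if "c' \<in> ?N +>\<^bsub>?F\<^esub> c" for c'
  proof -
    from that obtain n where n: "n \<in> ?N" "c' = n \<oplus>\<^bsub>?F\<^esub> c"
      by (auto simp: a_r_coset_def')
    moreover from n(1) have "n \<in> carrier ?F"
      using N.a_subset by blast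
    ultimately have "f \<odot>\<^bsub>?F\<^esub> c' = f \<odot>\<^bsub>?F\<^esub> n \<oplus>\<^bsub>?F\<^esub> f \<odot>\<^bsub>?F\<^esub> c"
      using assms by (simp add: F.smult_r_distr)
    moreover have "f \<odot>\<^bsub>?F\<^esub> n \<in> ?N"
      using assms(2) n(1) by (rule S.smult_closed)
    ultimately have "f \<odot>\<^bsub>?F\<^esub> c' \<in> ?N +>\<^bsub>?F\<^esub> (f \<odot>\<^bsub>?F\<^esub> c)"
      using assms by (auto simp: a_r_coset_def')
    then show ?thesis
      using F.M.a_repr_independence[OF _ _ N.a_subgroup] assms by auto
  qed
  \<comment> \<open>The union therefore ranges over a nonempty set, so it equals the common coset
    and is not empty.\<close>
  moreover have "c \<in> ?N +>\<^bsub>?F\<^esub> c"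
    using assms(3) by (rule N.a_rcos_self)
  ultimately show ?thesis
    unfolding kaehler_simps by blast
qed

lemma univ_deriv_closed:
  assumes "algebra R A" "h \<in> carrier A"
  shows "univ_deriv R A h \<in> carrier (kaehler R A)"
proof -
  interpret A: algebra R A by fact
  interpret N: abelian_subgroup "kaehler_submodule R A" "free_module A"
    using assms(1) by (rule abelian_subgroup_kaehler_submodule)
  show ?thesis
    unfolding kaehler_simps univ_deriv_def
    by (rule N.a_rcosetsI[OF N.a_subset free_gen_closed[OF A.M_cring assms(2)]])
qed

text \<open>Every differential is a finite sum of terms \<open>f\<close> times \<open>d h\<close>,
  because a coset has a finitely supported representative. No cases for zero or negatives occur:
  zero is itself such a term, and signs are absorbed by the coefficient \<open>f\<close>.\<close>

lemma kaehler_induct [consumes 2, case_names gen add]: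
  assumes "algebra R A" and "\<alpha> \<in> carrier (kaehler R A)"
    and gen: "\<And>f h. f \<in> carrier A \<Longrightarrow> h \<in> carrier A \<Longrightarrow> P (f \<odot>\<^bsub>kaehler R A\<^esub> univ_deriv R A h)"
    and add: "\<And>\<alpha> \<beta>. \<alpha> \<in> carrier (kaehler R A) \<Longrightarrow> \<beta> \<in> carrier (kaehler R A) \<Longrightarrow>
      P \<alpha> \<Longrightarrow> P \<beta> \<Longrightarrow> P (\<alpha> \<oplus>\<^bsub>kaehler R A\<^esub> \<beta>)"
  shows "P \<alpha>"
proof -
  interpret A: algebra R A by fact
  interpret F: module A "free_module A"
    using A.M_cring by (rule module_free_module)
  interpret N: abelian_subgroup "kaehler_submodule R A" "free_module A"
    using assms(1) by (rule abelian_subgroup_kaehler_submodule)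
  let ?F = "free_module A" and ?N = "kaehler_submodule R A"
  have genF: "free_gen A h \<in> carrier ?F" if "h \<in> carrier A" for h
    using A.M_cring that by (rule free_gen_closed)
  have single: "P (?N +>\<^bsub>?F\<^esub> (f \<odot>\<^bsub>?F\<^esub> free_gen A h))" if "f \<in> carrier A" "h \<in> carrier A" for f h
    using gen[OF that] kaehler_smult_coset[OF assms(1) that(1) genF[OF that(2)]]
    by (simp add: univ_deriv_def)
  \<comment> \<open>The induction runs over a finite set \<open>S\<close> that merely contains the
    support, so that removing a point \<open>h\<close> from \<open>S\<close> is harmless even when
    \<open>c h\<close> is zero.\<close>
  have supp: "P (?N +>\<^bsub>?F\<^esub> c)"
    if "finite S" "S \<subseteq> carrier A" "c \<in> carrier ?F" "{h. c h \<noteq> \<zero>\<^bsub>A\<^esub>} \<subseteq> S" for S c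
    using that
  proof (induction S arbitrary: c rule: finite_induct)
    case empty
    \<comment> \<open>The empty sum has to be presented as one generator term. The zero of the
      algebra serves as basis index because it surely lies in the carrier; the zero coefficient does
      the work.\<close>
    then have "c = \<zero>\<^bsub>A\<^esub> \<odot>\<^bsub>?F\<^esub> free_gen A \<zero>\<^bsub>A\<^esub>"
      by (auto simp: free_module_simps free_gen_def)
    then show ?case
      using single by simp
  next
    case (insert h S)
    let ?c = "c(h := \<zero>\<^bsub>A\<^esub>)"
    have ch: "c k \<in> carrier A" for k
      using insert.prems(2) by (simp add: mem_free_module_iff)
    have h: "h \<in> carrier A"
      using insert.prems(1) by simp
    \<comment> \<open>The coefficient at \<open>h\<close> is split off as a multiple of a basis
      element; the remainder is supported in \<open>S\<close>.\<close>
    have c: "c = ?c \<oplus>\<^bsub>?F\<^esub> c h \<odot>\<^bsub>?F\<^esub> free_gen A h"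
      using ch by (auto simp: free_module_simps free_gen_def)
    have sub: "{k. ?c k \<noteq> \<zero>\<^bsub>A\<^esub>} \<subseteq> S"
      using insert.prems(3) by auto
    then have cF: "?c \<in> carrier ?F"
      using insert.prems ch insert.hyps(1) by (auto simp: mem_free_module_iff intro: finite_subset)
    have gF: "c h \<odot>\<^bsub>?F\<^esub> free_gen A h \<in> carrier ?F"
      using ch genF[OF h] by simp
    have "P ((?N +>\<^bsub>?F\<^esub> ?c) \<oplus>\<^bsub>kaehler R A\<^esub> (?N +>\<^bsub>?F\<^esub> (c h \<odot>\<^bsub>?F\<^esub> free_gen A h)))"
    proof (rule add)
      show "P (?N +>\<^bsub>?F\<^esub> ?c)"
        by (rule insert.IH[OF _ cF sub]) (use insert.prems(1) in simp)
    qed (use cF gF single[OF ch h] F.M.a_rcosetsI[OF N.a_subset] in \<open>auto simp: kaehler_simps(1)\<close>)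
    then show ?case
      using N.a_rcos_sum[OF cF gF] by (simp add: kaehler_simps(2) flip: c)
  qed
  obtain c where "c \<in> carrier ?F" "\<alpha> = ?N +>\<^bsub>?F\<^esub> c"
    using assms(2) by (auto simp: kaehler_simps A_RCOSETS_def')
  then show ?thesis
    using supp[of "{h. c h \<noteq> \<zero>\<^bsub>A\<^esub>}" c] by (simp add: mem_free_module_iff)
qed

text \<open>Linearity over the algebra spreads the vanishing from exact differentials to all of
  them, one argument at a time: first the second argument with the first one exact, then the first
  with the second arbitrary.\<close>

lemma vanishing_map_kaehlerI:
  assumes "algebra R A" and "module A M"
    and bil: "bilinear_map A (kaehler R A) (kaehler R A) M K"
    and zero: "\<And>f g. f \<in> carrier A \<Longrightarrow> g \<in> carrier A \<Longrightarrow>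
      K (univ_deriv R A f) (univ_deriv R A g) = \<zero>\<^bsub>M\<^esub>"
  shows "vanishing_map (kaehler R A) (kaehler R A) M K"
proof -
  interpret M: module A M by fact
  note d = univ_deriv_closed[OF assms(1)]
  have right: "K (univ_deriv R A f) \<beta> = \<zero>\<^bsub>M\<^esub>"
    if f: "f \<in> carrier A" and "\<beta> \<in> carrier (kaehler R A)" for f \<beta>
    using assms(1) that(2)
  proof (induction rule: kaehler_induct)
    case (gen g h)
    then show ?case
      using bil zero[OF f] d f by (simp add: bilinear_map_def)
  next
    case (add \<alpha> \<beta>)
    then show ?case
      using bil d[OF f] by (simp add: bilinear_map_def)
  qed
  have "K \<alpha> \<beta> = \<zero>\<^bsub>M\<^esub>" if "\<alpha> \<in> carrier (kaehler R A)" and \<beta>: "\<beta> \<in> carrier (kaehler R A)" for \<alpha> \<beta>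
    using assms(1) that(1)
  proof (induction rule: kaehler_induct)
    case (gen g h)
    then show ?case
      using bil right \<beta> d by (simp add: bilinear_map_def)
  next
    case (add \<alpha> \<beta>)
    then show ?case
      using bil \<beta> by (simp add: bilinear_map_def)
  qed
  then show ?thesis
    by (simp add: vanishing_map_def)
qed

section \<open>Brackets induced by Poisson modules\<close>

lemma restrict_scalars_simps [simp]:
  "carrier (restrict_scalars A M) = carrier M"
  "\<zero>\<^bsub>restrict_scalars A M\<^esub> = \<zero>\<^bsub>M\<^esub>"
  "x \<oplus>\<^bsub>restrict_scalars A M\<^esub> y = x \<oplus>\<^bsub>M\<^esub> y"
  "r \<odot>\<^bsub>restrict_scalars A M\<^esub> x = (r \<odot>\<^bsub>A\<^esub> \<one>\<^bsub>A\<^esub>) \<odot>\<^bsub>M\<^esub> x"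
  by (simp_all add: restrict_scalars_def)

lemma semidirect_simps [simp]:
  "carrier (semidirect A M) = carrier A \<times> carrier M"
  "(f, \<eta>) \<otimes>\<^bsub>semidirect A M\<^esub> (g, \<xi>) = (f \<otimes>\<^bsub>A\<^esub> g, f \<odot>\<^bsub>M\<^esub> \<xi> \<oplus>\<^bsub>M\<^esub> g \<odot>\<^bsub>M\<^esub> \<eta>)"
  "\<zero>\<^bsub>semidirect A M\<^esub> = (\<zero>\<^bsub>A\<^esub>, \<zero>\<^bsub>M\<^esub>)"
  "(f, \<eta>) \<oplus>\<^bsub>semidirect A M\<^esub> (g, \<xi>) = (f \<oplus>\<^bsub>A\<^esub> g, \<eta> \<oplus>\<^bsub>M\<^esub> \<xi>)"
  "r \<odot>\<^bsub>semidirect A M\<^esub> (f, \<eta>) = (r \<odot>\<^bsub>A\<^esub> f, (r \<odot>\<^bsub>A\<^esub> \<one>\<^bsub>A\<^esub>) \<odot>\<^bsub>M\<^esub> \<eta>)"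
  by (simp_all add: semidirect_def)

lemma (in abelian_group) diff_zero: "a \<in> carrier G \<Longrightarrow> a \<ominus> \<zero> = a"
  by (simp add: minus_eq)

lemma (in abelian_group) eq_if_diff_eq_zero:
  "a \<in> carrier G \<Longrightarrow> b \<in> carrier G \<Longrightarrow> a \<ominus> b = \<zero> \<Longrightarrow> a = b"
  by (simp add: add.inv_solve_right' minus_eq)

lemma bilinear_mapD:
  assumes "bilinear_map R L M N b"
  shows "x \<in> carrier L \<Longrightarrow> y \<in> carrier M \<Longrightarrow> b x y \<in> carrier N"
    and "x \<in> carrier L \<Longrightarrow> x' \<in> carrier L \<Longrightarrow> y \<in> carrier M \<Longrightarrow>
      b (x \<oplus>\<^bsub>L\<^esub> x') y = b x y \<oplus>\<^bsub>N\<^esub> b x' y"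
    and "x \<in> carrier L \<Longrightarrow> y \<in> carrier M \<Longrightarrow> y' \<in> carrier M \<Longrightarrow>
      b x (y \<oplus>\<^bsub>M\<^esub> y') = b x y \<oplus>\<^bsub>N\<^esub> b x y'"
    and "r \<in> carrier R \<Longrightarrow> x \<in> carrier L \<Longrightarrow> y \<in> carrier M \<Longrightarrow>
      b (r \<odot>\<^bsub>L\<^esub> x) y = r \<odot>\<^bsub>N\<^esub> b x y"
    and "r \<in> carrier R \<Longrightarrow> x \<in> carrier L \<Longrightarrow> y \<in> carrier M \<Longrightarrow>
      b x (r \<odot>\<^bsub>M\<^esub> y) = r \<odot>\<^bsub>N\<^esub> b x y"
  using assms unfolding bilinear_map_def by simp_all

lemma bilinear_map_zero_left:
  assumes "bilinear_map R L M N b" "abelian_group L" "abelian_group N" "y \<in> carrier M"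
  shows "b \<zero>\<^bsub>L\<^esub> y = \<zero>\<^bsub>N\<^esub>"
proof -
  interpret L: abelian_group L by fact
  interpret N: abelian_group N by fact
  have "b (\<zero>\<^bsub>L\<^esub> \<oplus>\<^bsub>L\<^esub> \<zero>\<^bsub>L\<^esub>) y = b \<zero>\<^bsub>L\<^esub> y \<oplus>\<^bsub>N\<^esub> b \<zero>\<^bsub>L\<^esub> y" "b \<zero>\<^bsub>L\<^esub> y \<in> carrier N"
    using assms L.zero_closed unfolding bilinear_map_def by blast+
  then show ?thesis by simp
qed

lemma bilinear_map_zero_right:
  assumes "bilinear_map R L M N b" "abelian_group M" "abelian_group N" "x \<in> carrier L"
  shows "b x \<zero>\<^bsub>M\<^esub> = \<zero>\<^bsub>N\<^esub>"
proof -
  interpret M: abelian_group M by fact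
  interpret N: abelian_group N by fact
  have "b x (\<zero>\<^bsub>M\<^esub> \<oplus>\<^bsub>M\<^esub> \<zero>\<^bsub>M\<^esub>) = b x \<zero>\<^bsub>M\<^esub> \<oplus>\<^bsub>N\<^esub> b x \<zero>\<^bsub>M\<^esub>" "b x \<zero>\<^bsub>M\<^esub> \<in> carrier N"
    using assms M.zero_closed unfolding bilinear_map_def by blast+
  then show ?thesis by simp
qed

lemma abelian_group_restrict_scalars:
  assumes "abelian_group M"
  shows "abelian_group (restrict_scalars A M)"
proof -
  interpret M: abelian_group M by fact
  show ?thesis
    by (rule abelian_groupI) (auto simp: M.a_ac intro: bexI[of _ "\<ominus>\<^bsub>M\<^esub> _"] M.l_neg)
qed

text \<open>The map \<open>lam\<close> is recovered as the bracket of \<open>f\<close> in degree 0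
  with \<open>\<eta>\<close> in degree 1, so each axiom is the degree 1 component of an identity of
  the bracket \<open>br\<close>. The inducing formula only controls differences of values of
  \<open>lam\<close>; the two hypotheses on zero arguments isolate a single value.\<close>

lemma poisson_module_if_induced_by:
  assumes P0: "poisson_algebra R P0 br0" and M: "module P0 P1"
    and P: "poisson_algebra R (semidirect P0 P1) br"
    and ind: "induced_by P0 br0 P1 br lam"
    and closed: "\<And>f \<eta>. f \<in> carrier P0 \<Longrightarrow> \<eta> \<in> carrier P1 \<Longrightarrow> lam f \<eta> \<in> carrier P1"
    and lam_0_right: "\<And>f. f \<in> carrier P0 \<Longrightarrow> lam f \<zero>\<^bsub>P1\<^esub> = \<zero>\<^bsub>P1\<^esub>"
    and lam_0_left: "\<And>\<eta>. \<eta> \<in> carrier P1 \<Longrightarrow> lam \<zero>\<^bsub>P0\<^esub> \<eta> = \<zero>\<^bsub>P1\<^esub>"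
  shows "poisson_module R P0 br0 P1 lam"
proof -
  interpret A: algebra R P0
    using P0 by (simp add: poisson_algebra_def)
  interpret M: module P0 P1 by fact
  interpret S: algebra R "semidirect P0 P1"
    using P by (simp add: poisson_algebra_def)
  have bil0: "bilinear_map R P0 P0 P0 br0"
    using P0 by (simp add: poisson_algebra_def lie_bracket_def)
  have br0_closed: "br0 f g \<in> carrier P0" if "f \<in> carrier P0" "g \<in> carrier P0" for f g
    using bil0 that by (simp add: bilinear_map_def)
  have br0_0: "br0 f \<zero>\<^bsub>P0\<^esub> = \<zero>\<^bsub>P0\<^esub>" "br0 \<zero>\<^bsub>P0\<^esub> f = \<zero>\<^bsub>P0\<^esub>" if "f \<in> carrier P0" for f
    using bilinear_map_zero_right[OF bil0] bilinear_map_zero_left[OF bil0] that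
      A.M.abelian_group_axioms by blast+
  let ?S = "semidirect P0 P1"
  let ?a = "\<lambda>f. (f, \<zero>\<^bsub>P1\<^esub>)" and ?m = "\<lambda>\<eta>. (\<zero>\<^bsub>P0\<^esub>, \<eta>)"
  have bil: "bilinear_map R ?S ?S ?S br"
    using P by (simp add: poisson_algebra_def lie_bracket_def)
  have leibniz: "br (x \<otimes>\<^bsub>?S\<^esub> y) z = x \<otimes>\<^bsub>?S\<^esub> br y z \<oplus>\<^bsub>?S\<^esub> y \<otimes>\<^bsub>?S\<^esub> br x z"
      "br z (x \<otimes>\<^bsub>?S\<^esub> y) = x \<otimes>\<^bsub>?S\<^esub> br z y \<oplus>\<^bsub>?S\<^esub> y \<otimes>\<^bsub>?S\<^esub> br z x"
    and jacobi: "br x (br y z) \<oplus>\<^bsub>?S\<^esub> br y (br z x) \<oplus>\<^bsub>?S\<^esub> br z (br x y) = \<zero>\<^bsub>?S\<^esub>"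
    if "x \<in> carrier ?S" "y \<in> carrier ?S" "z \<in> carrier ?S" for x y z
    using P that unfolding poisson_algebra_def lie_bracket_def by blast+
  \<comment> \<open>The next three facts are the multiplication table of the bracket on homogeneous
    elements: degree 0 with degree 1 in both orders, and degree 0 with itself.\<close>
  have am: "br (?a f) (?m \<eta>) = ?m (lam f \<eta>)" if "f \<in> carrier P0" "\<eta> \<in> carrier P1" for f \<eta>
    using ind that br0_0 lam_0_left closed by (simp add: induced_by_def M.M.minus_eq)
  have ma: "br (?m \<eta>) (?a f) = ?m (\<ominus>\<^bsub>P1\<^esub> lam f \<eta>)" if "f \<in> carrier P0" "\<eta> \<in> carrier P1" for f \<eta>
    using ind that br0_0 lam_0_left closed by (simp add: induced_by_def M.M.minus_eq)
  have aa: "br (?a f) (?a g) = ?a (br0 f g)" if "f \<in> carrier P0" "g \<in> carrier P0" for f g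
    using ind that lam_0_right by (simp add: induced_by_def M.M.minus_eq)
  have lin: "bilinear_map R P0 (restrict_scalars P0 P1) (restrict_scalars P0 P1) lam"
    unfolding bilinear_map_def restrict_scalars_simps
  proof (intro conjI ballI)
    fix f g \<eta> assume c: "f \<in> carrier P0" "g \<in> carrier P0" "\<eta> \<in> carrier P1"
    have "br (?a f \<oplus>\<^bsub>?S\<^esub> ?a g) (?m \<eta>) = br (?a f) (?m \<eta>) \<oplus>\<^bsub>?S\<^esub> br (?a g) (?m \<eta>)"
      by (intro bilinear_mapD(2)[OF bil]) (use c in simp_all)
    then show "lam (f \<oplus>\<^bsub>P0\<^esub> g) \<eta> = lam f \<eta> \<oplus>\<^bsub>P1\<^esub> lam g \<eta>"
      using c by (simp add: am)
  next
    fix f \<eta> \<xi> assume c: "f \<in> carrier P0" "\<eta> \<in> carrier P1" "\<xi> \<in> carrier P1"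
    have "br (?a f) (?m \<eta> \<oplus>\<^bsub>?S\<^esub> ?m \<xi>) = br (?a f) (?m \<eta>) \<oplus>\<^bsub>?S\<^esub> br (?a f) (?m \<xi>)"
      by (intro bilinear_mapD(3)[OF bil]) (use c in simp_all)
    then show "lam f (\<eta> \<oplus>\<^bsub>P1\<^esub> \<xi>) = lam f \<eta> \<oplus>\<^bsub>P1\<^esub> lam f \<xi>"
      using c by (simp add: am)
  next
    fix r f \<eta> assume c: "r \<in> carrier R" "f \<in> carrier P0" "\<eta> \<in> carrier P1"
    have "br (r \<odot>\<^bsub>?S\<^esub> ?a f) (?m \<eta>) = r \<odot>\<^bsub>?S\<^esub> br (?a f) (?m \<eta>)"
      by (intro bilinear_mapD(4)[OF bil]) (use c in simp_all)
    then show "lam (r \<odot>\<^bsub>P0\<^esub> f) \<eta> = (r \<odot>\<^bsub>P0\<^esub> \<one>\<^bsub>P0\<^esub>) \<odot>\<^bsub>P1\<^esub> lam f \<eta>"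
      using c by (simp add: am)
    have "br (?a f) (r \<odot>\<^bsub>?S\<^esub> ?m \<eta>) = r \<odot>\<^bsub>?S\<^esub> br (?a f) (?m \<eta>)"
      by (intro bilinear_mapD(5)[OF bil]) (use c in simp_all)
    then show "lam f ((r \<odot>\<^bsub>P0\<^esub> \<one>\<^bsub>P0\<^esub>) \<odot>\<^bsub>P1\<^esub> \<eta>) = (r \<odot>\<^bsub>P0\<^esub> \<one>\<^bsub>P0\<^esub>) \<odot>\<^bsub>P1\<^esub> lam f \<eta>"
      using c by (simp add: am)
  qed (use closed in auto)
  \<comment> \<open>This serves the Jacobi identity below, where \<open>ma\<close> puts a sign
    inside the argument of \<open>lam g\<close>.\<close>
  have minus: "lam f (\<ominus>\<^bsub>P1\<^esub> \<eta>) = \<ominus>\<^bsub>P1\<^esub> lam f \<eta>" if "f \<in> carrier P0" "\<eta> \<in> carrier P1" for f \<eta>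
  proof -
    have "lam f (\<ominus>\<^bsub>P1\<^esub> \<eta>) \<oplus>\<^bsub>P1\<^esub> lam f \<eta> = lam f (\<ominus>\<^bsub>P1\<^esub> \<eta> \<oplus>\<^bsub>P1\<^esub> \<eta>)"
      using lin that by (simp add: bilinear_map_def)
    then show ?thesis
      using that closed lam_0_right by (simp add: M.M.l_neg M.M.minus_equality)
  qed
  have axs: "lam f (g \<odot>\<^bsub>P1\<^esub> \<eta>) = g \<odot>\<^bsub>P1\<^esub> lam f \<eta> \<oplus>\<^bsub>P1\<^esub> br0 f g \<odot>\<^bsub>P1\<^esub> \<eta> \<and>
        lam (f \<otimes>\<^bsub>P0\<^esub> g) \<eta> = f \<odot>\<^bsub>P1\<^esub> lam g \<eta> \<oplus>\<^bsub>P1\<^esub> g \<odot>\<^bsub>P1\<^esub> lam f \<eta> \<and>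
        lam (br0 f g) \<eta> = lam f (lam g \<eta>) \<ominus>\<^bsub>P1\<^esub> lam g (lam f \<eta>)"
    if c: "f \<in> carrier P0" "g \<in> carrier P0" "\<eta> \<in> carrier P1" for f g \<eta>
  proof (intro conjI)
    \<comment> \<open>The product of \<open>?a g\<close> and \<open>?m \<eta>\<close> is
      \<open>g\<close> acting on \<open>\<eta>\<close>. In the last summand the degree 0 bracket
      \<open>br0 f g\<close> acts on \<open>\<eta>\<close>, which gives the anchor term.\<close>
    have "br (?a f) (?a g \<otimes>\<^bsub>?S\<^esub> ?m \<eta>)
        = ?a g \<otimes>\<^bsub>?S\<^esub> br (?a f) (?m \<eta>) \<oplus>\<^bsub>?S\<^esub> ?m \<eta> \<otimes>\<^bsub>?S\<^esub> br (?a f) (?a g)"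
      by (rule leibniz(2)) (use c in simp_all)
    then show "lam f (g \<odot>\<^bsub>P1\<^esub> \<eta>) = g \<odot>\<^bsub>P1\<^esub> lam f \<eta> \<oplus>\<^bsub>P1\<^esub> br0 f g \<odot>\<^bsub>P1\<^esub> \<eta>"
      using c by (simp add: am aa closed br0_closed)
    have "br (?a f \<otimes>\<^bsub>?S\<^esub> ?a g) (?m \<eta>)
        = ?a f \<otimes>\<^bsub>?S\<^esub> br (?a g) (?m \<eta>) \<oplus>\<^bsub>?S\<^esub> ?a g \<otimes>\<^bsub>?S\<^esub> br (?a f) (?m \<eta>)"
      by (rule leibniz(1)) (use c in simp_all)
    then show "lam (f \<otimes>\<^bsub>P0\<^esub> g) \<eta> = f \<odot>\<^bsub>P1\<^esub> lam g \<eta> \<oplus>\<^bsub>P1\<^esub> g \<odot>\<^bsub>P1\<^esub> lam f \<eta>"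
      using c by (simp add: am closed)
    \<comment> \<open>The three cyclic terms are \<open>lam f (lam g \<eta>)\<close>, minus
      \<open>lam g (lam f \<eta>)\<close> and minus \<open>lam (br0 f g) \<eta>\<close>.\<close>
    have "br (?a f) (br (?a g) (?m \<eta>)) \<oplus>\<^bsub>?S\<^esub> br (?a g) (br (?m \<eta>) (?a f))
        \<oplus>\<^bsub>?S\<^esub> br (?m \<eta>) (br (?a f) (?a g)) = \<zero>\<^bsub>?S\<^esub>"
      by (rule jacobi) (use c in simp_all)
    then have "lam f (lam g \<eta>) \<ominus>\<^bsub>P1\<^esub> lam g (lam f \<eta>) \<ominus>\<^bsub>P1\<^esub> lam (br0 f g) \<eta> = \<zero>\<^bsub>P1\<^esub>"
      using c by (simp add: am ma aa closed br0_closed minus M.M.minus_eq)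
    then show "lam (br0 f g) \<eta> = lam f (lam g \<eta>) \<ominus>\<^bsub>P1\<^esub> lam g (lam f \<eta>)"
      using c M.M.eq_if_diff_eq_zero[symmetric] by (simp add: closed br0_closed)
  qed
  show ?thesis
    unfolding poisson_module_def using lin axs by blast
qed

section \<open>The equivalence and the formula for the module structure\<close>

theorem corollary9p3:
  fixes R :: "('r, 's) ring_scheme"
    and P0 :: "('r, 'a) module"
    and br0 :: "'a \<Rightarrow> 'a \<Rightarrow> 'a"
    and P1 :: "('a, 'm) module"
    and br :: "'a \<times> 'm \<Rightarrow> 'a \<times> 'm \<Rightarrow> 'a \<times> 'm"
    and br1 :: "'m \<Rightarrow> 'm \<Rightarrow> 'm"
    and D :: "('a \<Rightarrow> 'a) set \<Rightarrow> 'm \<Rightarrow> 'm"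
    and K :: "('a \<Rightarrow> 'a) set \<Rightarrow> ('a \<Rightarrow> 'a) set \<Rightarrow> 'm"
  assumes "cring R"
    and "poisson_algebra R P0 br0"
    and "faithful_module P0 P1"
    and "admissible_poisson R P0 br0 P1 br"
    and "corresponding_poisson_triple R P0 br0 P1 br br1 D K"
  shows "((\<exists>lam. poisson_module R P0 br0 P1 lam \<and> induced_by P0 br0 P1 br lam) \<longleftrightarrow>
      vanishing_map P1 P1 P1 br1 \<and> vanishing_map (kaehler R P0) (kaehler R P0) P1 K) \<and>
    (vanishing_map P1 P1 P1 br1 \<and> vanishing_map (kaehler R P0) (kaehler R P0) P1 K \<longrightarrow>
      (\<forall>lam. poisson_module R P0 br0 P1 lam \<and> induced_by P0 br0 P1 br lam \<longleftrightarrow>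
        (\<forall>f\<in>carrier P0. \<forall>\<eta>\<in>carrier P1. lam f \<eta> = D (univ_deriv R P0 f) \<eta>)))"
proof -
  have alg: "algebra R P0"
    using assms(2) by (simp add: poisson_algebra_def)
  have mod: "module P0 P1"
    using assms(3) by (simp add: faithful_module_def)
  interpret A: algebra R P0 by (rule alg)
  interpret M: module P0 P1 by (rule mod)
  have agM: "abelian_group P1" by unfold_locales
  let ?d = "univ_deriv R P0" and ?\<Omega> = "kaehler R P0"
  note d = univ_deriv_closed[OF alg]
  have P: "poisson_algebra R (semidirect P0 P1) br"
    using assms(4) by (simp add: admissible_poisson_def)
  have bil1: "bilinear_map P0 P1 P1 P1 br1"
    and bilD: "bilinear_map R (restrict_scalars P0 ?\<Omega>) (restrict_scalars P0 P1)
      (restrict_scalars P0 P1) D"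
    and bilK: "bilinear_map P0 ?\<Omega> ?\<Omega> P1 K"
    and br: "\<And>f \<eta> g \<xi>. f \<in> carrier P0 \<Longrightarrow> \<eta> \<in> carrier P1 \<Longrightarrow> g \<in> carrier P0 \<Longrightarrow> \<xi> \<in> carrier P1 \<Longrightarrow>
      br (f, \<eta>) (g, \<xi>) =
        (br0 f g, D (?d f) \<xi> \<ominus>\<^bsub>P1\<^esub> D (?d g) \<eta> \<oplus>\<^bsub>P1\<^esub> br1 \<eta> \<xi> \<oplus>\<^bsub>P1\<^esub> K (?d f) (?d g))"
    using assms(5) by (simp_all add: corresponding_poisson_triple_def contravariant_derivative_def
        lie_bracket_def Let_def)
  have br1_closed: "br1 \<eta> \<xi> \<in> carrier P1" if "\<eta> \<in> carrier P1" "\<xi> \<in> carrier P1" for \<eta> \<xi>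
    using bil1 that by (simp add: bilinear_map_def)
  have D_closed: "D (?d f) \<eta> \<in> carrier P1" if "f \<in> carrier P0" "\<eta> \<in> carrier P1" for f \<eta>
    using bilD that d by (simp add: bilinear_map_def)
  have K_closed: "K (?d f) (?d g) \<in> carrier P1" if "f \<in> carrier P0" "g \<in> carrier P0" for f g
    using bilK that d by (simp add: bilinear_map_def)
  have D_0: "D (?d f) \<zero>\<^bsub>P1\<^esub> = \<zero>\<^bsub>P1\<^esub>" if "f \<in> carrier P0" for f
    using bilinear_map_zero_right[OF bilD abelian_group_restrict_scalars[OF agM]
        abelian_group_restrict_scalars[OF agM], of "?d f"] d[OF that] by simp
  have br1_0: "br1 \<eta> \<zero>\<^bsub>P1\<^esub> = \<zero>\<^bsub>P1\<^esub>" "br1 \<zero>\<^bsub>P1\<^esub> \<eta> = \<zero>\<^bsub>P1\<^esub>" if "\<eta> \<in> carrier P1" for \<eta>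
    using bilinear_map_zero_right[OF bil1 agM agM that] bilinear_map_zero_left[OF bil1 agM agM that]
    by blast+
  have only_if: "vanishing_map P1 P1 P1 br1 \<and> vanishing_map ?\<Omega> ?\<Omega> P1 K \<and>
      (\<forall>f\<in>carrier P0. \<forall>\<eta>\<in>carrier P1. lam f \<eta> = D (?d f) \<eta>)"
    if pm: "poisson_module R P0 br0 P1 lam" and ind: "induced_by P0 br0 P1 br lam" for lam
  proof -
    have bilL: "bilinear_map R P0 (restrict_scalars P0 P1) (restrict_scalars P0 P1) lam"
      using pm by (simp add: poisson_module_def)
    have lam_closed: "lam f \<eta> \<in> carrier P1" if "f \<in> carrier P0" "\<eta> \<in> carrier P1" for f \<eta>
      using bilL that by (simp add: bilinear_map_def)
    have lam_0: "lam f \<zero>\<^bsub>P1\<^esub> = \<zero>\<^bsub>P1\<^esub>" if "f \<in> carrier P0" for f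
      using bilinear_map_zero_right[OF bilL abelian_group_restrict_scalars[OF agM]
        abelian_group_restrict_scalars[OF agM] that] by simp
    have lam_0': "lam \<zero>\<^bsub>P0\<^esub> \<eta> = \<zero>\<^bsub>P1\<^esub>" if "\<eta> \<in> carrier P1" for \<eta>
      using bilinear_map_zero_left[OF bilL A.M.abelian_group_axioms
        abelian_group_restrict_scalars[OF agM], of \<eta>] that by simp
    \<comment> \<open>Both descriptions of the bracket have the same degree 1 component. Setting
      arguments to zero then isolates one term after another, and each later step uses the earlier
      ones.\<close>
    have eq: "D (?d f) \<xi> \<ominus>\<^bsub>P1\<^esub> D (?d g) \<eta> \<oplus>\<^bsub>P1\<^esub> br1 \<eta> \<xi> \<oplus>\<^bsub>P1\<^esub> K (?d f) (?d g)
        = lam f \<xi> \<ominus>\<^bsub>P1\<^esub> lam g \<eta>"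
      if "f \<in> carrier P0" "\<eta> \<in> carrier P1" "g \<in> carrier P0" "\<xi> \<in> carrier P1" for f \<eta> g \<xi>
      using ind br[OF that] that by (simp add: induced_by_def)
    have K0: "K (?d f) (?d g) = \<zero>\<^bsub>P1\<^esub>" if "f \<in> carrier P0" "g \<in> carrier P0" for f g
      using eq[OF that(1) M.M.zero_closed that(2) M.M.zero_closed] that
      by (simp add: D_0 br1_0 K_closed lam_0 M.M.minus_eq)
    \<comment> \<open>This is read off from the bracket, with \<open>lam\<close> vanishing at zero,
      instead of from the relation d 0 = 0 among differentials. It clears the derivative terms when
      \<open>br1\<close> is isolated next.\<close>
    have D0: "D (?d \<zero>\<^bsub>P0\<^esub>) \<xi> = \<zero>\<^bsub>P1\<^esub>" if "\<xi> \<in> carrier P1" for \<xi>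
      using eq[OF A.M.zero_closed M.M.zero_closed A.M.zero_closed that] that
      by (simp add: D_0 br1_0 K0 lam_0 lam_0' D_closed M.M.minus_eq)
    have "br1 \<eta> \<xi> = \<zero>\<^bsub>P1\<^esub>" if "\<eta> \<in> carrier P1" "\<xi> \<in> carrier P1" for \<eta> \<xi>
      using eq[OF A.M.zero_closed that(1) A.M.zero_closed that(2)] that
      by (simp add: D0 K0 lam_0' br1_closed M.M.minus_eq)
    then have "vanishing_map P1 P1 P1 br1"
      by (simp add: vanishing_map_def)
    moreover have "vanishing_map ?\<Omega> ?\<Omega> P1 K"
      using alg mod bilK K0 by (rule vanishing_map_kaehlerI)
    moreover have "lam f \<eta> = D (?d f) \<eta>" if "f \<in> carrier P0" "\<eta> \<in> carrier P1" for f \<eta>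
      using eq[OF that(1) M.M.zero_closed A.M.zero_closed that(2)] that
      by (simp add: D_0 br1_0 K0 lam_0 D_closed lam_closed M.M.minus_eq)
    ultimately show ?thesis
      by blast
  qed
  \<comment> \<open>Here \<open>lam\<close> is any map agreeing with the derivative along exact
    differentials on the carriers, because the final equivalence quantifies over all total functions
    \<open>lam\<close>.\<close>
  have "if": "poisson_module R P0 br0 P1 lam \<and> induced_by P0 br0 P1 br lam"
    if van: "vanishing_map P1 P1 P1 br1" "vanishing_map ?\<Omega> ?\<Omega> P1 K"
      and lam: "\<And>f \<eta>. f \<in> carrier P0 \<Longrightarrow> \<eta> \<in> carrier P1 \<Longrightarrow> lam f \<eta> = D (?d f) \<eta>" for lam
  proof
    show ind: "induced_by P0 br0 P1 br lam"
      using van by (simp add: induced_by_def br lam vanishing_map_def d D_closed)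
    have bil: "bilinear_map R (semidirect P0 P1) (semidirect P0 P1) (semidirect P0 P1) br"
      using P by (simp add: poisson_algebra_def lie_bracket_def)
    have agS: "abelian_group (semidirect P0 P1)"
      using P algebra.M_cring[of R "semidirect P0 P1"]
      by (simp add: poisson_algebra_def cring_def ring_def)
    \<comment> \<open>Again d 0 = 0 is bypassed: bilinearity makes the bracket with the zero of the
      semidirect product vanish, and its degree 1 component is \<open>lam\<close> at zero up to the
      term \<open>lam\<close> of two zeros, which is zero by \<open>D_0\<close>.\<close>
    have "lam \<zero>\<^bsub>P0\<^esub> \<eta> = \<zero>\<^bsub>P1\<^esub>" if "\<eta> \<in> carrier P1" for \<eta>
    proof -
      have "br (\<zero>\<^bsub>P0\<^esub>, \<zero>\<^bsub>P1\<^esub>) (\<zero>\<^bsub>P0\<^esub>, \<eta>) = (\<zero>\<^bsub>P0\<^esub>, \<zero>\<^bsub>P1\<^esub>)"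
        using bilinear_map_zero_left[OF bil agS agS, of "(\<zero>\<^bsub>P0\<^esub>, \<eta>)"] that by simp
      moreover have "br (\<zero>\<^bsub>P0\<^esub>, \<zero>\<^bsub>P1\<^esub>) (\<zero>\<^bsub>P0\<^esub>, \<eta>) =
          (br0 \<zero>\<^bsub>P0\<^esub> \<zero>\<^bsub>P0\<^esub>, lam \<zero>\<^bsub>P0\<^esub> \<eta> \<ominus>\<^bsub>P1\<^esub> lam \<zero>\<^bsub>P0\<^esub> \<zero>\<^bsub>P1\<^esub>)"
        using ind that by (simp add: induced_by_def)
      ultimately show ?thesis
        using that by (simp add: lam D_0 D_closed M.M.diff_zero)
    qed
    then show "poisson_module R P0 br0 P1 lam"
      using poisson_module_if_induced_by[OF assms(2) mod P ind] lam D_closed D_0 by simp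
  qed
  show ?thesis
    \<comment> \<open>The explicit instance is the witness for existence; \<open>only_if\<close>
      shows that every inducing structure agrees with it on the carriers.\<close>
    using only_if "if"[of "\<lambda>f. D (?d f)"] "if" by blast
qed

end
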